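(* Let $r\ge1$ be real, $p\in(0,1)$, $q=1-p$, and let $$\pi_k=\frac{\Gamma(r+k)}{\Gamma(r)\,k!}p^rq^k,\qquad k\ge0,$$ be the negative binomial $\operatorname{NB}(r,p)$ mass function. Let $$C_0^{\rm NB}(r,p):=\sup_{k\ge1}\frac{F_{k-1}Q_k}{k\,\pi_k},\qquad F_{k-1}:=\sum_{j=0}^{k-1}\pi_j,\qquad Q_k:=\sum_{j\ge k}\pi_j ,$$ and $$\kappa(q):=\min_{0\le e\le1-q}\left\{e^2+\left(\frac{1+q-e}{2-e}\right)^2\right\}.$$ Then $$C_0^{\rm NB}(r,p)\le\min\left\{1,\frac1{\sqrt{2q(r-1)+\kappa(q)}}\right\},$$ and, in particular, $$C_0^{\rm NB}(r,p)\le\min\left\{1,\frac1{\sqrt{q(2r-1)}}\right\}.$$ For $r=1$, $C_0^{\rm NB}(1,p)=1$ exactly.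
   Context: $C_0^{\rm NB}(r,p)$ equals the uniform Stein solution factor $\sup_{A\subseteq\mathbb N_0}\|g_A\|_\infty$, where $g_A$ with $g_A(0)=0$ solves $q(r+k)g_A(k+1)-kg_A(k)=\mathbf 1_A(k)-\mathbb P(Z\in A)$, $k\ge0$, $Z\sim\operatorname{NB}(r,p)$. *)

theory Defs
  imports "HOL-Analysis.Analysis"
begin

text \<open>
  Negative binomial law with real shape parameter \<open>r\<close> and success probability \<open>p\<close>
  (the library's \<open>neg_binomial_pmf\<close> only covers integer \<open>r\<close>). Throughout, \<open>q = 1 - p\<close>.
\<close>

definition nb_mass :: "real \<Rightarrow> real \<Rightarrow> nat \<Rightarrow> real" where
  "nb_mass r p k = Gamma (r + real k) / (Gamma r * fact k) * p powr r * (1 - p) ^ k"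

definition nb_cdf :: "real \<Rightarrow> real \<Rightarrow> nat \<Rightarrow> real" where
  "nb_cdf r p n = (\<Sum>j\<le>n. nb_mass r p j)"

definition nb_tail :: "real \<Rightarrow> real \<Rightarrow> nat \<Rightarrow> real" where
  "nb_tail r p k = (\<Sum>\<^sub>\<infinity>j\<in>{k..}. nb_mass r p j)"

text \<open>
  The supremum is taken in the extended reals, so that an upper bound on \<open>nb_C0\<close> carries
  the boundedness of the family; in the reals the supremum of an unbounded set is a dummy value.
\<close>

definition nb_C0 :: "real \<Rightarrow> real \<Rightarrow> ereal" where
  "nb_C0 r p = (SUP k\<in>{1..}. ereal (nb_cdf r p (k - 1) * nb_tail r p k / (real k * nb_mass r p k)))"

definition nb_kappa :: "real \<Rightarrow> real" where
  "nb_kappa q = (INF e\<in>{0..1 - q}. e\<^sup>2 + ((1 + q - e) / (2 - e))\<^sup>2)"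

text \<open>The infimum defining \<open>nb_kappa\<close> is a minimum.\<close>

lemma nb_kappa_attained:
  assumes "0 < q" "q < 1"
  shows "\<exists>e\<in>{0..1 - q}. nb_kappa q = e\<^sup>2 + ((1 + q - e) / (2 - e))\<^sup>2 \<and>
           (\<forall>e'\<in>{0..1 - q}. nb_kappa q \<le> e'\<^sup>2 + ((1 + q - e') / (2 - e'))\<^sup>2)"
proof -
  let ?f = "\<lambda>e::real. e\<^sup>2 + ((1 + q - e) / (2 - e))\<^sup>2"
  have "continuous_on {0..1 - q} ?f"
    using assms by (intro continuous_intros) auto
  moreover have "{0..1 - q} \<noteq> {}" using assms by simp
  ultimately obtain e where e: "e \<in> {0..1 - q}" "\<And>e'. e' \<in> {0..1 - q} \<Longrightarrow> ?f e \<le> ?f e'"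
    using continuous_attains_inf[OF compact_Icc] by blast
  have "nb_kappa q = ?f e"
    unfolding nb_kappa_def by (rule cInf_eq_minimum) (use e in auto)
  with e show ?thesis by auto
qed

text \<open>\<open>nb_mass\<close> is a probability mass function; in particular \<open>nb_tail\<close> is a convergent sum.\<close>

lemma nb_mass_pos:
  assumes "0 < r" "0 < p" "p < 1"
  shows "0 < nb_mass r p k"
  using assms by (auto simp: nb_mass_def Gamma_real_pos intro!: mult_pos_pos divide_pos_pos)

lemma nb_mass_sums:
  assumes "0 < r" "0 < p" "p < 1"
  shows "nb_mass r p sums 1"
proof -
  have "(\<lambda>n. ((- r) gchoose n) * (p - 1) ^ n) sums (1 + (p - 1)) powr (- r)"
    by (rule gen_binomial_real) (use assms in auto)
  then have "(\<lambda>n. p powr r * (((- r) gchoose n) * (p - 1) ^ n)) sums (p powr r * p powr (- r))"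
    by (intro sums_mult) simp
  moreover have "p powr r * p powr (- r) = 1"
    using assms by (simp add: powr_minus)
  moreover have "p powr r * (((- r) gchoose n) * (p - 1) ^ n) = nb_mass r p n" for n
  proof -
    have "r \<notin> \<int>\<^sub>\<le>\<^sub>0" using assms by (auto elim!: nonpos_Ints_cases)
    then have "pochhammer r n = Gamma (r + real n) / Gamma r"
      by (rule pochhammer_Gamma)
    moreover have "((- r) gchoose n) = (- 1) ^ n * pochhammer r n / fact n"
      by (simp add: gbinomial_pochhammer)
    moreover have "(- 1) ^ n * (p - 1) ^ n = (1 - p) ^ n"
      by (simp flip: power_mult_distrib)
    ultimately show ?thesis
      by (simp add: nb_mass_def mult_ac)
  qed
  ultimately show ?thesis by simp
qed

lemma nb_mass_summable_on:
  assumes "0 < r" "0 < p" "p < 1"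
  shows "nb_mass r p summable_on A"
proof -
  have "nb_mass r p summable_on UNIV"
    using nb_mass_sums[OF assms] nb_mass_pos[OF assms]
    by (intro norm_summable_imp_summable_on) (auto simp: sums_iff abs_of_pos)
  then show ?thesis by (rule summable_on_subset_banach) simp
qed

end

theory Submission
  imports Defs
begin

text \<open>
  Write \<open>F = F\<^bsub>k-1\<^esub>\<close>, \<open>Q = Q\<^sub>k\<close>, \<open>X = k \<pi>\<^sub>k / F\<close>, \<open>Y = k \<pi>\<^sub>k / Q\<close>; as \<open>F + Q = 1\<close>, the quantity to be
  bounded is \<open>1 / (X + Y)\<close>. Put \<open>m = q (r + k - 1)\<close> and \<open>d = k - m\<close>.
  The bound \<open>1\<close> is \<open>X \<ge> 1 - d\<close> plus \<open>Y \<ge> d\<close>. The latter also shows that the quantity tends to \<open>0\<close>,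
  so the supremum is attained at some \<open>k\<close>. Comparing this \<open>k\<close> with its neighbours \<open>k + 1\<close> and
  \<open>k - 1\<close> gives \<open>X Y \<ge> k (e - q)\<close> and \<open>X Y \<ge> m (1 - e)\<close> for \<open>e = d + X - Y\<close>. Now
  \<open>(X + Y)\<^sup>2 = (e - d)\<^sup>2 + 4 X Y\<close>, and the resulting lower bound is least where the two linear
  functions of \<open>e\<close> cross, with value \<open>2 q (r - 1) + d\<^sup>2 + ((q k + m) / (k + m))\<^sup>2\<close>. Finally \<open>k \<ge> 1\<close>
  bounds the last two terms below by \<open>\<kappa>(q)\<close>, the worst case being \<open>k = 1\<close> with \<open>d\<close> as the
  minimisation variable.
\<close>

section \<open>Bounds on the minimum \<kappa>(q)\<close>

lemma nb_kappa_le: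
  assumes "0 < q" "q < 1" "0 \<le> e" "e \<le> 1 - q"
  shows "nb_kappa q \<le> e\<^sup>2 + ((1 + q - e) / (2 - e))\<^sup>2"
  using nb_kappa_attained[OF assms(1,2)] assms(3,4) by auto

text \<open>Eliminating \<open>q\<close> in favour of the quotient \<open>t\<close> makes
  \<open>e\<^sup>2 + t\<^sup>2 - q\<close> a sum of squares. This turns the \<kappa>(q) bound into
  the simpler one with q(2r - 1).\<close>

lemma nb_kappa_ge:
  assumes "0 < q" "q < 1"
  shows "q \<le> nb_kappa q"
proof -
  obtain e where e: "e \<in> {0..1 - q}" "nb_kappa q = e\<^sup>2 + ((1 + q - e) / (2 - e))\<^sup>2"
    using nb_kappa_attained[OF assms] by blast
  define t where "t = (1 + q - e) / (2 - e)"
  have "t * (2 - e) = 1 + q - e"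
    using e assms by (simp add: t_def)
  then have q: "q = t * (2 - e) - 1 + e" by simp
  have "e\<^sup>2 + t\<^sup>2 - q = (1 - t - e / 2)\<^sup>2 + 3 / 4 * e\<^sup>2"
    unfolding q by (simp add: power2_eq_square field_simps)
  moreover have "0 \<le> (1 - t - e / 2)\<^sup>2 + 3 / 4 * e\<^sup>2" by simp
  ultimately show ?thesis
    unfolding e(2) t_def[symmetric] by linarith
qed

text \<open>Each range of \<open>d = k - m\<close> is compared with one admissible point of the
  minimum: 0 if \<open>d\<close> is negative, \<open>d\<close> itself if admissible, and the
  endpoint \<open>1 - q\<close> beyond.\<close>

lemma nb_kappa_le_crossing:
  fixes k m q :: real
  assumes q: "0 < q" "q < 1" and k: "1 \<le> k" and m: "q * k \<le> m"
  shows "nb_kappa q \<le> (k - m)\<^sup>2 + ((q * k + m) / (k + m))\<^sup>2"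
proof -
  define d where "d = k - m"
  define e where "e = (q * k + m) / (k + m)"
  have "0 \<le> q * k" using q k by simp
  then have km: "0 < k + m" using k m by linarith
  have "nb_kappa q \<le> d\<^sup>2 + e\<^sup>2"
  proof -
    consider "d < 0" | "0 \<le> d" "d \<le> 1 - q" | "1 - q < d" by linarith
    then show ?thesis
    proof cases
      case 1
      have "0 \<le> (1 - q) * (m - k)" using 1 q by (simp add: d_def)
      then have "(1 + q) / 2 \<le> e"
        using km by (simp add: e_def field_simps)
      then have "((1 + q) / 2)\<^sup>2 \<le> e\<^sup>2"
        using q by (intro power_mono) auto
      with nb_kappa_le[OF q, of 0] q show ?thesis
        by (simp add: add_increasing)
    next
      case 2
      \<comment> \<open>This is the cross-multiplied difference of the two fractions; it vanishes at
        \<open>k = 1\<close>, where \<open>e\<close> equals the quotient in \<kappa>(q).\<close>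
      have "0 \<le> d * (1 - q) * (k - 1)" using 2 q k by simp
      also have "\<dots> = (q * k + m) * (2 - d) - (1 + q - d) * (k + m)"
        by (simp add: d_def algebra_simps)
      finally have "(1 + q - d) / (2 - d) \<le> e"
        using km 2 q by (simp add: e_def divide_simps)
      then have "((1 + q - d) / (2 - d))\<^sup>2 \<le> e\<^sup>2"
        using 2 q by (intro power_mono) auto
      with nb_kappa_le[OF q 2] show ?thesis by simp
    next
      case 3
      have "0 \<le> (1 - q) * (m - q * k)" using q m by simp
      then have "2 * q / (1 + q) \<le> e"
        using km q by (simp add: e_def divide_simps) (simp add: algebra_simps)
      then have "(2 * q / (1 + q))\<^sup>2 \<le> e\<^sup>2"
        using q by (intro power_mono) auto
      moreover have "(1 - q)\<^sup>2 \<le> d\<^sup>2"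
        using 3 q by (intro power_mono) auto
      ultimately show ?thesis
        using nb_kappa_le[OF q, of "1 - q"] q by simp
    qed
  qed
  then show ?thesis by (simp add: d_def e_def)
qed

lemma sum_square_ge_crossing:
  fixes k m q X Y :: real
  assumes q: "0 < q" "q < 1" and k: "1 \<le> k" and m: "0 < m"
    and fwd: "(k + X) * (k - Y) \<le> k * (m + q)"
    and bwd: "(m - X) * (m + Y) \<le> m * (k - 1)"
  shows "2 * (m - q * k) + (k - m)\<^sup>2 + ((q * k + m) / (k + m))\<^sup>2 \<le> (X + Y)\<^sup>2"
proof -
  define d where "d = k - m"
  define e where "e = d + X - Y"
  \<comment> \<open>The crossing point of \<open>k * (e - q)\<close> and \<open>m * (1 - e)\<close>
    as functions of \<open>e\<close>: the mean of \<open>q\<close> and 1 with weights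
    \<open>k\<close> and \<open>m\<close>.\<close>
  define c where "c = (q * k + m) / (k + m)"
  have km: "0 < k + m" using k m by simp
  have A: "k * (e - q) \<le> X * Y"
    using fwd by (simp add: e_def d_def algebra_simps)
  have B: "m * (1 - e) \<le> X * Y"
    using bwd by (simp add: e_def d_def algebra_simps)
  have S: "(X + Y)\<^sup>2 = (e - d)\<^sup>2 + 4 * (X * Y)"
    by (simp add: e_def power2_eq_square algebra_simps)
  have c: "0 < c" "c < 1"
    using q k m by (auto simp: c_def divide_simps intro!: add_pos_pos)
  have cAB: "k * (c - q) = m * (1 - c)"
    using km by (simp add: c_def field_simps)
  have val: "2 * (m - q * k) + d\<^sup>2 + c\<^sup>2 = (c - d)\<^sup>2 + 4 * (m * (1 - c))"
  proof -
    have ck: "c * (k + m) = q * k + m" using km by (simp add: c_def)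
    have "2 * (m - q * k) + d\<^sup>2 + c\<^sup>2 - ((c - d)\<^sup>2 + 4 * (m * (1 - c)))
        = 2 * (c * (k + m)) - 2 * (q * k + m)"
      by (simp add: d_def power2_eq_square algebra_simps)
    with ck show ?thesis by simp
  qed
  have "(c - d)\<^sup>2 + 4 * (m * (1 - c)) \<le> (X + Y)\<^sup>2"
  proof (cases "c \<le> e")
    case True
    \<comment> \<open>The second factor is \<open>2 * (k + m) + e + c\<close>, so the bound from
      \<open>A\<close> only grows to the right of \<open>c\<close>.\<close>
    have "0 \<le> (e - c) * ((e + c - 2 * d) + 4 * k)"
      using True c k m by (intro mult_nonneg_nonneg) (auto simp: d_def)
    also have "\<dots> = (e - d)\<^sup>2 + 4 * (k * (e - q)) - ((c - d)\<^sup>2 + 4 * (k * (c - q)))"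
      by (simp add: power2_eq_square algebra_simps)
    finally show ?thesis using A S cAB by linarith
  next
    case False
    \<comment> \<open>The second factor is \<open>2 * (k + m) - e - c\<close>, positive because
      \<open>e < c < 1 \<le> k\<close>.\<close>
    have "0 \<le> (c - e) * (4 * m + 2 * d - e - c)"
      using False c k m by (intro mult_nonneg_nonneg) (auto simp: d_def)
    also have "\<dots> = (e - d)\<^sup>2 + 4 * (m * (1 - e)) - ((c - d)\<^sup>2 + 4 * (m * (1 - c)))"
      by (simp add: power2_eq_square algebra_simps)
    finally show ?thesis using B S by linarith
  qed
  with val show ?thesis by (simp add: d_def c_def)
qed

section \<open>Recurrence for the masses, distribution function and tail\<close>

lemma nb_mass_Suc:
  assumes "0 < r"
  shows "real (Suc k) * nb_mass r p (Suc k) = (1 - p) * (r + real k) * nb_mass r p k"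
proof -
  have "r + real k \<notin> \<int>\<^sub>\<le>\<^sub>0" using assms by (auto elim!: nonpos_Ints_cases)
  then have "Gamma (r + real (Suc k)) = (r + real k) * Gamma (r + real k)"
    using Gamma_plus1[of "r + real k"] by (simp add: add_ac)
  moreover have "Gamma r > 0" using assms by (rule Gamma_real_pos)
  ultimately show ?thesis
    by (simp add: nb_mass_def divide_simps del: of_nat_Suc)
qed

lemma nb_cdf_Suc: "nb_cdf r p (Suc n) = nb_cdf r p n + nb_mass r p (Suc n)"
  by (simp add: nb_cdf_def)

context
  fixes r p :: real
  assumes r: "1 \<le> r" and p: "0 < p" "p < 1"
begin

lemma mass_pos: "0 < nb_mass r p k"
  using nb_mass_pos r p by simp

lemma cdf_pos: "0 < nb_cdf r p n"
  unfolding nb_cdf_def by (intro sum_pos mass_pos) auto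

lemma tail_Suc: "nb_tail r p k = nb_mass r p k + nb_tail r p (Suc k)"
proof -
  have "{k..} = insert k {Suc k..}" by auto
  then show ?thesis
    unfolding nb_tail_def using r p
    by (simp add: infsum_insert nb_mass_summable_on)
qed

lemma cdf_add_tail: "nb_cdf r p n + nb_tail r p (Suc n) = 1"
proof (induction n)
  case 0
  have "nb_tail r p 0 = 1"
  proof -
    have "(nb_mass r p has_sum nb_tail r p 0) UNIV"
      unfolding nb_tail_def using r p nb_mass_summable_on[of r p UNIV]
      by (simp add: atLeast_0 has_sum_infsum)
    then have "nb_mass r p sums nb_tail r p 0" by (rule has_sum_imp_sums)
    with nb_mass_sums[of r p] r p show ?thesis
      using sums_unique2 by simp blast
  qed
  then show ?case using tail_Suc[of 0] by (simp add: nb_cdf_def)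
next
  case (Suc n)
  then show ?case using tail_Suc[of "Suc n"] by (simp add: nb_cdf_Suc)
qed

lemma tail_pos: "0 < nb_tail r p k"
proof -
  have "0 \<le> nb_tail r p (Suc k)"
    unfolding nb_tail_def by (intro infsum_nonneg less_imp_le mass_pos)
  then show ?thesis using tail_Suc[of k] mass_pos[of k] by simp
qed

section \<open>Drift bounds for the distribution function and the tail\<close>

text \<open>For \<open>k \<ge> 1\<close> the subtracted term is
  \<open>k * \<pi>\<^sub>k / \<pi>\<^sub>k\<^sub>-\<^sub>1\<close>, so the drift is positive exactly
  where the masses decrease.\<close>

definition drift :: "nat \<Rightarrow> real" where
  "drift k = real k - (1 - p) * (r + real k - 1)"

lemma drift_Suc: "drift (Suc k) = drift k + p"
  by (simp add: drift_def algebra_simps)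

lemma drift_le: "drift k \<le> p * real k"
proof -
  have "0 \<le> (1 - p) * (r - 1)" using r p by simp
  then show ?thesis by (simp add: drift_def algebra_simps)
qed

text \<open>Equality holds at \<open>n = 0\<close>, and each induction step discards only the
  nonnegative term \<open>p * ?F\<close>, since the drift rises by \<open>p\<close>. Division by
  \<open>nb_cdf r p n\<close> gives \<open>X \<ge> 1 - d\<close>.\<close>

lemma cdf_bound: "(1 - drift (Suc n)) * nb_cdf r p n \<le> real (Suc n) * nb_mass r p (Suc n)"
proof (induction n)
  case 0
  show ?case
    using nb_mass_Suc[of r 0 p] r by (simp add: drift_def nb_cdf_def)
next
  case (Suc n)
  let ?F = "nb_cdf r p n" and ?d = "drift (Suc n)" and ?k = "real (Suc n)"
    and ?w = "nb_mass r p (Suc n)"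
  have "0 \<le> p * ?F" using cdf_pos[of n] p by simp
  have "(1 - drift (Suc (Suc n))) * nb_cdf r p (Suc n)
      = (1 - ?d) * ?F - p * ?F + (1 - p - ?d) * ?w"
    by (simp add: drift_Suc[of "Suc n"] nb_cdf_Suc algebra_simps)
  also have "\<dots> \<le> ?k * ?w + (1 - p - ?d) * ?w"
    using Suc \<open>0 \<le> p * ?F\<close> by linarith
  also have "\<dots> = (1 - p) * (r + ?k) * ?w"
    by (simp add: drift_def algebra_simps)
  also have "\<dots> = real (Suc (Suc n)) * nb_mass r p (Suc (Suc n))"
    using nb_mass_Suc[of r "Suc n" p] r by simp
  finally show ?case .
qed

text \<open>The terms \<open>\<pi>\<^sub>j\<close> are dominated by the differences of \<open>j \<pi>\<^sub>j / drift j\<close>, and the sum telescopes.\<close>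

lemma tail_bound:
  assumes d: "0 < drift k"
  shows "drift k * nb_tail r p k \<le> real k * nb_mass r p k"
proof -
  define U where "U j = real j * nb_mass r p j / drift j" for j
  have dpos: "0 < drift j" if "k \<le> j" for j
    using that by (induction rule: dec_induct) (use d p in \<open>auto simp: drift_Suc\<close>)
  have step: "nb_mass r p j \<le> U j - U (Suc j)" if "k \<le> j" for j
  proof -
    let ?d = "drift j" and ?w = "nb_mass r p j"
    have d: "0 < ?d" using dpos that by simp
    have "(1 - p) * (r + real j) = real j - ?d + (1 - p)"
      by (simp add: drift_def algebra_simps)
    then have "U (Suc j) = (real j - ?d + (1 - p)) * ?w / (?d + p)"
      unfolding U_def drift_Suc using nb_mass_Suc[of r j p] r by simp
    then have "U j - U (Suc j) - ?w
        = real j * ?w / ?d - (real j - ?d + (1 - p)) * ?w / (?d + p) - ?w"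
      by (simp only: U_def)
    also have "\<dots> = (p * real j - ?d) * ?w / (?d * (?d + p))"
      using d p by (simp add: divide_simps) (simp add: algebra_simps)
    finally have "U j - U (Suc j) - ?w = (p * real j - ?d) * ?w / (?d * (?d + p))" .
    \<comment> \<open>Here \<open>p * real j - ?d\<close> equals (1 - p)(r - 1), so the sign comes
      from r \<ge> 1.\<close>
    moreover have "0 \<le> (p * real j - ?d) * ?w / (?d * (?d + p))"
      using d p drift_le[of j] mass_pos[of j] by simp
    ultimately show ?thesis by linarith
  qed
  have partial: "(\<Sum>j\<in>{k..<k + n}. nb_mass r p j) \<le> U k - U (k + n)" for n
  proof (induction n)
    case (Suc n)
    then show ?case using step[of "k + n"] by simp
  qed simp
  have "nb_tail r p k \<le> U k"
    unfolding nb_tail_def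
  proof (rule infsum_le_finite_sums)
    show "nb_mass r p summable_on {k..}" using nb_mass_summable_on r p by simp
  next
    fix A assume A: "finite A" "A \<subseteq> {k..}"
    then obtain N where N: "A \<subseteq> {..<N}" using finite_nat_iff_bounded by blast
    have "sum (nb_mass r p) A \<le> sum (nb_mass r p) {k..<k + N}"
    proof (rule sum_mono2)
      show "A \<subseteq> {k..<k + N}" using A N by fastforce
    qed (auto intro: less_imp_le mass_pos)
    also have "\<dots> \<le> U k - U (k + N)" by (rule partial)
    also have "\<dots> \<le> U k"
      using dpos[of "k + N"] mass_pos[of "k + N"] by (simp add: U_def)
    finally show "sum (nb_mass r p) A \<le> U k" .
  qed
  then show ?thesis
    using d by (simp add: U_def field_simps)
qed

section \<open>The ratio and its reciprocal \<open>X + Y\<close>\<close>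

text \<open>Indexed by \<open>n = k - 1\<close>, which avoids truncated subtraction in the
  distribution function.\<close>

definition ratio :: "nat \<Rightarrow> real" where
  "ratio n = nb_cdf r p n * nb_tail r p (Suc n) / (real (Suc n) * nb_mass r p (Suc n))"

definition hazard_sum :: "nat \<Rightarrow> real" where
  "hazard_sum n = real (Suc n) * nb_mass r p (Suc n) / nb_cdf r p n
     + real (Suc n) * nb_mass r p (Suc n) / nb_tail r p (Suc n)"

lemma ratio_pos: "0 < ratio n"
  using cdf_pos mass_pos tail_pos by (simp add: ratio_def del: of_nat_Suc)

lemma ratio_eq: "ratio n = 1 / hazard_sum n"
proof -
  have *: "F * Q / w = 1 / (w / F + w / Q)" if "0 < F" "0 < Q" "0 < w" "F + Q = 1" for F Q w :: real
  proof -
    have "w / F + w / Q = w * (F + Q) / (F * Q)"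
      using that(1,2,3) by (simp add: field_simps)
    then show ?thesis using that by simp
  qed
  show ?thesis
    unfolding ratio_def hazard_sum_def
    using cdf_pos mass_pos tail_pos cdf_add_tail by (intro *) auto
qed

lemma hazard_sum_pos: "0 < hazard_sum n"
  using ratio_pos[of n] by (simp add: ratio_eq)

lemma tail_hazard_ge_drift:
  "drift (Suc n) \<le> real (Suc n) * nb_mass r p (Suc n) / nb_tail r p (Suc n)"
proof (cases "0 < drift (Suc n)")
  case True
  then show ?thesis
    using tail_bound[of "Suc n"] tail_pos[of "Suc n"] by (simp add: field_simps)
next
  case False
  moreover have "0 < real (Suc n) * nb_mass r p (Suc n) / nb_tail r p (Suc n)"
    using mass_pos tail_pos by (simp del: of_nat_Suc)
  ultimately show ?thesis by linarith
qed

lemma hazard_sum_ge_drift: "drift (Suc n) \<le> hazard_sum n"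
proof -
  have "0 < real (Suc n) * nb_mass r p (Suc n) / nb_cdf r p n"
    using mass_pos cdf_pos by (simp del: of_nat_Suc)
  with tail_hazard_ge_drift[of n] show ?thesis
    unfolding hazard_sum_def by linarith
qed

lemma hazard_sum_ge_1: "1 \<le> hazard_sum n"
proof -
  have "1 - drift (Suc n) \<le> real (Suc n) * nb_mass r p (Suc n) / nb_cdf r p n"
    using cdf_bound[of n] cdf_pos[of n] by (simp add: field_simps)
  with tail_hazard_ge_drift[of n] show ?thesis
    unfolding hazard_sum_def by linarith
qed

section \<open>A maximiser and its two neighbours\<close>

lemma ratio_attains_max: "\<exists>n. \<forall>i. ratio i \<le> ratio n"
proof -
  \<comment> \<open>The drift grows by \<open>p\<close> per step and bounds
    \<open>hazard_sum\<close> from below, so beyond \<open>N\<close> the ratio stays below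
    \<open>ratio 0\<close> and a maximum over \<open>{..N}\<close> is global.\<close>
  obtain N :: nat where N: "hazard_sum 0 - drift 0 < real N * p"
    using reals_Archimedean3[OF p(1)] by blast
  obtain n where n: "n \<in> {..N}" "\<And>i. i \<in> {..N} \<Longrightarrow> ratio i \<le> ratio n"
    using obtains_MAX[of "{..N}" ratio]
    by (metis Max_ge atMost_iff empty_iff finite_atMost finite_imageI image_eqI order_refl)
  have "ratio i \<le> ratio n" for i
  proof (cases "i \<le> N")
    case True
    then show ?thesis using n by simp
  next
    case False
    have "drift i = drift 0 + real i * p" for i
      by (induction i) (auto simp: drift_Suc algebra_simps)
    then have "drift (Suc i) = drift 0 + real (Suc i) * p" .
    moreover have "real N * p \<le> real (Suc i) * p"
      using False p by (intro mult_right_mono) auto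
    ultimately have "hazard_sum 0 \<le> hazard_sum i"
      using N hazard_sum_ge_drift[of i] by linarith
    then have "ratio i \<le> ratio 0"
      unfolding ratio_eq using hazard_sum_pos[of 0] by (intro divide_left_mono) auto
    also have "\<dots> \<le> ratio n" using n by simp
    finally show ?thesis .
  qed
  then show ?thesis by blast
qed

lemma hazard_sum_square_ge:
  assumes max: "\<And>i. ratio i \<le> ratio n"
  shows "2 * (1 - p) * (r - 1) + nb_kappa (1 - p) \<le> (hazard_sum n)\<^sup>2"
proof -
  define k where "k = real (Suc n)"
  define m where "m = (1 - p) * (r + k - 1)"
  define w where "w = nb_mass r p (Suc n)"
  define F where "F = nb_cdf r p n"
  define Q where "Q = nb_tail r p (Suc n)"
  define X where "X = k * w / F"
  define Y where "Y = k * w / Q"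
  have k: "1 \<le> k" by (simp add: k_def)
  have pos: "0 < w" "0 < F" "0 < Q"
    using mass_pos cdf_pos tail_pos by (auto simp: w_def F_def Q_def)
  have "0 < r + k - 1" using r k by simp
  then have m: "0 < m" using p by (simp add: m_def)
  have mq: "m + (1 - p) = (1 - p) * (r + k)" by (simp add: m_def algebra_simps)
  have mk: "m - (1 - p) * k = (1 - p) * (r - 1)" by (simp add: m_def algebra_simps)
  \<comment> \<open>Comparison with the successor, which moves the mass \<open>w\<close> from the
    tail to the distribution function: \<open>k + X = k * (F + w) / F\<close> and
    \<open>k - Y = k * (Q - w) / Q\<close>.\<close>
  have fwd: "(k + X) * (k - Y) \<le> k * (m + (1 - p))"
  proof -
    have "ratio (Suc n) = (F + w) * (Q - w) / ((m + (1 - p)) * w)"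
      using nb_mass_Suc[of r "Suc n" p] r tail_Suc[of "Suc n"]
      by (simp add: ratio_def nb_cdf_Suc F_def Q_def w_def mq k_def del: of_nat_Suc)
    moreover have "ratio n = F * Q / (k * w)"
      by (simp add: ratio_def F_def Q_def w_def k_def)
    ultimately have "(F + w) * (Q - w) / ((m + (1 - p)) * w) \<le> F * Q / (k * w)"
      using max[of "Suc n"] by simp
    then have "k * ((F + w) * (Q - w)) \<le> (m + (1 - p)) * (F * Q)"
      using pos k m p by (simp add: divide_simps mult_ac)
    then have "k * (k * ((F + w) * (Q - w))) / (F * Q) \<le> k * ((m + (1 - p)) * (F * Q)) / (F * Q)"
      using pos k by (intro divide_right_mono mult_left_mono) auto
    moreover have "(k + X) * (k - Y) = k * (k * ((F + w) * (Q - w))) / (F * Q)"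
      using pos by (simp add: X_def Y_def field_simps)
    ultimately show ?thesis using pos by simp
  qed
  have bwd: "(m - X) * (m + Y) \<le> m * (k - 1)"
  proof -
    define v where "v = nb_mass r p n"
    have v: "0 < v" using mass_pos by (simp add: v_def)
    \<comment> \<open>Hence \<open>m - X = m * (F - v) / F\<close> and
      \<open>m + Y = m * (Q + v) / Q\<close>, the factors in the comparison with the
      predecessor.\<close>
    have kw: "k * w = m * v"
      using nb_mass_Suc[of r n p] r by (simp add: k_def w_def m_def v_def algebra_simps)
    show ?thesis
    proof (cases n)
      \<comment> \<open>There is no predecessor, but \<open>X = m\<close> and \<open>k = 1\<close>,
        so both sides vanish.\<close>
      case 0
      then have "F = v" "k = 1" by (simp_all add: F_def v_def nb_cdf_def k_def)
      then show ?thesis using kw v by (simp add: X_def)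
    next
      case (Suc j)
      have "ratio j = (F - v) * (Q + v) / ((k - 1) * v)"
        using tail_Suc[of n] Suc
        by (simp add: ratio_def nb_cdf_Suc F_def Q_def v_def k_def add_ac)
      moreover have "ratio n = F * Q / (m * v)"
        by (simp add: ratio_def F_def Q_def kw[symmetric] w_def k_def)
      ultimately have "(F - v) * (Q + v) / ((k - 1) * v) \<le> F * Q / (m * v)"
        using max[of j] by simp
      moreover have "0 < k - 1" using Suc by (simp add: k_def)
      ultimately have "m * ((F - v) * (Q + v)) \<le> (k - 1) * (F * Q)"
        using pos v m by (simp add: divide_simps mult_ac)
      then have "m * (m * ((F - v) * (Q + v))) / (F * Q) \<le> m * ((k - 1) * (F * Q)) / (F * Q)"
        using pos m by (intro divide_right_mono mult_left_mono) auto
      moreover have "(m - X) * (m + Y) = m * (m * ((F - v) * (Q + v))) / (F * Q)"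
        using pos by (simp add: X_def Y_def kw field_simps)
      ultimately show ?thesis using pos by simp
    qed
  qed
  have "2 * (m - (1 - p) * k) + (k - m)\<^sup>2 + (((1 - p) * k + m) / (k + m))\<^sup>2 \<le> (X + Y)\<^sup>2"
    using p k m fwd bwd by (intro sum_square_ge_crossing) auto
  moreover have "nb_kappa (1 - p) \<le> (k - m)\<^sup>2 + (((1 - p) * k + m) / (k + m))\<^sup>2"
  proof (rule nb_kappa_le_crossing)
    have "0 \<le> (1 - p) * (r - 1)" using p r by simp
    with mk show "(1 - p) * k \<le> m" by linarith
  qed (use p k in auto)
  moreover have "hazard_sum n = X + Y"
    by (simp add: hazard_sum_def X_def Y_def k_def w_def F_def Q_def)
  ultimately show ?thesis using mk by (simp only: mult.assoc)
qed

section \<open>Bounds on the supremum\<close>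

lemma nb_C0_eq: "nb_C0 r p = (SUP n. ereal (ratio n))"
proof -
  have "{1..} = range Suc"
    by (auto simp: image_iff) (metis Suc_le_D)
  then show ?thesis
    by (simp add: nb_C0_def ratio_def image_image del: of_nat_Suc)
qed

lemma nb_C0_le_1: "nb_C0 r p \<le> 1"
  unfolding nb_C0_eq
proof (rule SUP_least)
  show "ereal (ratio n) \<le> 1" for n
    using hazard_sum_ge_1[of n] by (simp add: ratio_eq)
qed

text \<open>The free constant \<open>a\<close> lets one argument serve both square-root bounds. The
  estimate at the maximiser controls every other index.\<close>

lemma nb_C0_le_sqrt:
  assumes "0 < a" "a \<le> 2 * (1 - p) * (r - 1) + nb_kappa (1 - p)"
  shows "nb_C0 r p \<le> ereal (1 / sqrt a)"
  unfolding nb_C0_eq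
proof (rule SUP_least)
  fix i
  obtain n where n: "\<And>i. ratio i \<le> ratio n" using ratio_attains_max by blast
  have "sqrt a \<le> hazard_sum n"
    using hazard_sum_square_ge[OF n] assms hazard_sum_pos[of n] by (intro real_le_lsqrt) auto
  then have "ratio n \<le> 1 / sqrt a"
    unfolding ratio_eq using assms hazard_sum_pos[of n] by (intro divide_left_mono) auto
  with n[of i] show "ereal (ratio i) \<le> ereal (1 / sqrt a)" by simp
qed

end

lemma nb_C0_one:
  assumes p: "0 < p" "p < 1"
  shows "nb_C0 1 p = 1"
proof (rule antisym)
  show "nb_C0 1 p \<le> 1" using nb_C0_le_1[of 1 p] p by simp
  \<comment> \<open>In this geometric case the term at \<open>k = 1\<close> is p(1 - p) / ((1 - p)p)
    = 1, which meets the upper bound.\<close>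
  have "nb_mass 1 p 0 = p" using p by (simp add: nb_mass_def)
  moreover from this have "nb_mass 1 p 1 = (1 - p) * p"
    using nb_mass_Suc[of 1 0 p] by simp
  moreover from calculation have "nb_cdf 1 p 0 = p" by (simp add: nb_cdf_def)
  moreover from this have "nb_tail 1 p 1 = 1 - p"
    using cdf_add_tail[of 1 p 0] p by simp
  ultimately have "nb_cdf 1 p (1 - 1) * nb_tail 1 p 1 / (real 1 * nb_mass 1 p 1) = 1"
    using p by simp
  then show "1 \<le> nb_C0 1 p"
    unfolding nb_C0_def by (intro SUP_upper2[of 1]) auto
qed

theorem corollary4p5:
  fixes r p q :: real
  assumes "1 \<le> r" and "0 < p" and "p < 1" and "q = 1 - p"
  shows "nb_C0 r p \<le> ereal (min 1 (1 / sqrt (2 * q * (r - 1) + nb_kappa q)))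
       \<and> nb_C0 r p \<le> ereal (min 1 (1 / sqrt (q * (2 * r - 1))))
       \<and> nb_C0 1 p = 1"
proof -
  have q: "0 < q" "q < 1" using assms by auto
  have kappa: "q \<le> nb_kappa q" using nb_kappa_ge q by simp
  have R: "0 \<le> q * (r - 1)" using q assms by simp
  have le: "q * (2 * r - 1) \<le> 2 * q * (r - 1) + nb_kappa q"
    using kappa by (simp add: algebra_simps)
  have pos: "0 < q * (2 * r - 1)"
    using q assms by simp
  note bound = nb_C0_le_sqrt[OF assms(1-3), folded assms(4)]
  have "nb_C0 r p \<le> ereal (1 / sqrt (2 * q * (r - 1) + nb_kappa q))"
    using bound[of "2 * q * (r - 1) + nb_kappa q"] le pos by simp
  moreover have "nb_C0 r p \<le> ereal (1 / sqrt (q * (2 * r - 1)))"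
    using bound[OF pos le] .
  moreover have "nb_C0 r p \<le> 1" using nb_C0_le_1 assms by simp
  ultimately show ?thesis
    using nb_C0_one assms(2,3) by (simp add: min_def one_ereal_def)
qed

end
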